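(* Let $T$ be a finite forest. If $T$ has no edges, then $\chi_{\mathrm{ISC}}(T)=|V(T)|$. If $v$ is a stem in $T$ and $R$ is the set of leaf neighbors of $v$, with $r=|R|$, then \[ \chi_{\mathrm{ISC}}(T) = \begin{cases} \chi_{\mathrm{ISC}}(T-R-v)+r+1+u_r, & \text{if } r+1 \text{ is not a triangular number},\\ \chi_{\mathrm{ISC}}(T-R)+r+u_r, & \text{if } r+1 \text{ is a triangular number.}\end{cases}\]
   Context: Interactive sum choice game on a finite graph $G$ between Requester and Supplier: initially every vertex $x$ has an empty list $L(x)$ of colors (colors from a countably infinite set). In each round Requester selects a vertex $x$ and Supplier adds to $L(x)$ a color not already in $L(x)$. The game ends as soon as $G$ has a proper coloring $\phi$ with $\phi(x)\in L(x)$ for all $x$. Requester wants to minimize the number of rounds and Supplier to maximize it; $\chi_{\mathrm{ISC}}(G)$ is the number of rounds under optimal play (the value both players can guarantee). A leaf is a vertex of degree 1; a stem in a forest is a vertex having a leaf neighbor and at most one non-leaf neighbor. For integers $k\ge0$, $t_k=\binom{k+1}{2}$; a triangular number is $t_k$ with $k\ge1$; $u_r=\max\{k\ge0:t_k\le r\}$. *)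

theory Defs
  imports "Graph_Theory.Digraph_Component" "Graph_Theory.Arc_Walk"
begin

text \<open>
  Finite simple graphs are the locale \<open>graph\<close> of the AFP entry Graph-Theory: an edge \<open>xy\<close> is
  the pair of arcs \<open>x \<rightarrow> y\<close> and \<open>y \<rightarrow> x\<close>.  Hence every edge gives rise to a directed cycle of
  length 2, the library's predicate \<open>forest\<close> holds for edgeless graphs only, and the cycles of
  the undirected graph are the directed cycles of length at least 3.
\<close>

definition finite_forest :: "('a,'b) pre_digraph \<Rightarrow> bool" where
  "finite_forest G \<longleftrightarrow> graph G \<and> \<not> (\<exists>p. pre_digraph.cycle G p \<and> length p \<ge> 3)"

definition neighbors :: "('a,'b) pre_digraph \<Rightarrow> 'a \<Rightarrow> 'a set" where
  "neighbors G x = {y. x \<rightarrow>\<^bsub>G\<^esub> y}"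

definition leaf :: "('a,'b) pre_digraph \<Rightarrow> 'a \<Rightarrow> bool" where
  "leaf G x \<longleftrightarrow> x \<in> verts G \<and> out_degree G x = 1"

definition leaf_neighbors :: "('a,'b) pre_digraph \<Rightarrow> 'a \<Rightarrow> 'a set" where
  "leaf_neighbors G x = {y \<in> neighbors G x. leaf G y}"

definition stem :: "('a,'b) pre_digraph \<Rightarrow> 'a \<Rightarrow> bool" where
  "stem G x \<longleftrightarrow> x \<in> verts G \<and> leaf_neighbors G x \<noteq> {} \<and>
     card {y \<in> neighbors G x. \<not> leaf G y} \<le> 1"

definition delete_verts :: "('a,'b) pre_digraph \<Rightarrow> 'a set \<Rightarrow> ('a,'b) pre_digraph" where
  "delete_verts G S = G \<restriction> (verts G - S)"

subsection \<open>The interactive sum choice game\<close>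

text \<open>A position of the game is the assignment \<open>L\<close> of lists; the colors are natural numbers.\<close>

definition list_colorable :: "('a,'b) pre_digraph \<Rightarrow> ('a \<Rightarrow> nat set) \<Rightarrow> bool" where
  "list_colorable G L \<longleftrightarrow> (\<exists>\<phi>. (\<forall>x\<in>verts G. \<phi> x \<in> L x) \<and> (\<forall>x y. x \<rightarrow>\<^bsub>G\<^esub> y \<longrightarrow> \<phi> x \<noteq> \<phi> y))"

definition add_color :: "('a \<Rightarrow> nat set) \<Rightarrow> 'a \<Rightarrow> nat \<Rightarrow> ('a \<Rightarrow> nat set)" where
  "add_color L x c = L(x := insert c (L x))"

text \<open>From position \<open>L\<close>, Requester can force the game to end after at most \<open>n\<close> further rounds.\<close>

primrec requester_forces :: "('a,'b) pre_digraph \<Rightarrow> nat \<Rightarrow> ('a \<Rightarrow> nat set) \<Rightarrow> bool" where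
  "requester_forces G 0 L \<longleftrightarrow> list_colorable G L"
| "requester_forces G (Suc n) L \<longleftrightarrow> list_colorable G L \<or>
     (\<exists>x\<in>verts G. \<forall>c. c \<notin> L x \<longrightarrow> requester_forces G n (add_color L x c))"

text \<open>From position \<open>L\<close>, Supplier can force the game to last for at least \<open>n\<close> further rounds.\<close>

primrec supplier_forces :: "('a,'b) pre_digraph \<Rightarrow> nat \<Rightarrow> ('a \<Rightarrow> nat set) \<Rightarrow> bool" where
  "supplier_forces G 0 L \<longleftrightarrow> True"
| "supplier_forces G (Suc n) L \<longleftrightarrow> \<not> list_colorable G L \<and>
     (\<forall>x\<in>verts G. \<exists>c. c \<notin> L x \<and> supplier_forces G n (add_color L x c))"

definition chi_ISC :: "('a,'b) pre_digraph \<Rightarrow> nat" where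
  "chi_ISC G = (THE n. requester_forces G n (\<lambda>_. {}) \<and> supplier_forces G n (\<lambda>_. {}))"

subsection \<open>The value is well defined\<close>

lemma supplier_forces_Suc_iff:
  assumes "\<And>x. finite (L x)"
  shows "supplier_forces G (Suc n) L \<longleftrightarrow> \<not> requester_forces G n L"
  using assms
proof (induction n arbitrary: L)
  case 0
  have "\<exists>c. c \<notin> L x" for x
    using 0 ex_new_if_finite infinite_UNIV_nat by blast
  then show ?case by simp
next
  case (Suc n)
  have "supplier_forces G (Suc n) (add_color L x c) \<longleftrightarrow> \<not> requester_forces G n (add_color L x c)"
    for x c
    using Suc.prems by (intro Suc.IH) (simp add: add_color_def)
  then show ?case
    by (subst supplier_forces.simps) auto
qed

lemma requester_forces_mono:
  "requester_forces G m L \<Longrightarrow> m \<le> n \<Longrightarrow> requester_forces G n L"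
proof (induction m arbitrary: L n)
  case 0
  then show ?case by (cases n) auto
next
  case (Suc m)
  then obtain k where "n = Suc k" "m \<le> k" by (cases n) auto
  with Suc.IH Suc.prems(1) show ?case by simp blast
qed

lemma distinct_choice:
  assumes "finite A" "\<And>x. x \<in> A \<Longrightarrow> card A \<le> card (L x)" "\<And>x. x \<in> A \<Longrightarrow> finite (L x)"
  shows "\<exists>\<phi>. inj_on \<phi> A \<and> (\<forall>x\<in>A. \<phi> x \<in> L x)"
  using assms
proof (induction A rule: finite_induct)
  case empty
  then show ?case by simp
next
  case (insert a A)
  have "\<exists>\<phi>. inj_on \<phi> A \<and> (\<forall>x\<in>A. \<phi> x \<in> L x)"
    using insert.prems insert.hyps by (intro insert.IH) force+
  then obtain \<phi> where \<phi>: "inj_on \<phi> A" "\<forall>x\<in>A. \<phi> x \<in> L x" by blast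
  have "card (\<phi> ` A) < card (L a)"
    using insert.prems(1)[of a] insert.hyps card_image_le[of A \<phi>] by simp
  then have "\<not> L a \<subseteq> \<phi> ` A"
    using insert.hyps by (meson card_mono finite_imageI not_le)
  then obtain c where c: "c \<in> L a" "c \<notin> \<phi> ` A" by blast
  have eq: "(\<phi>(a := c)) ` A = \<phi> ` A"
    using insert.hyps by auto
  have "inj_on (\<phi>(a := c)) (insert a A)"
    using \<phi>(1) c insert.hyps eq
    by (auto simp: inj_on_def)
  moreover have "\<forall>x\<in>insert a A. (\<phi>(a := c)) x \<in> L x"
    using \<phi>(2) c by auto
  ultimately show ?case by blast
qed

lemma (in graph) ex_requester_forces:
  assumes "\<And>x. finite (L x)"
  shows "\<exists>n. requester_forces G n L"
proof -
  have "requester_forces G n L"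
    if "(\<Sum>x\<in>verts G. card (verts G) - card (L x)) \<le> n" "\<And>x. finite (L x)" for n L
    using that
  proof (induction n arbitrary: L)
    case 0
    then have "\<And>x. x \<in> verts G \<Longrightarrow> card (verts G) \<le> card (L x)" by simp
    then obtain \<phi> where "inj_on \<phi> (verts G)" "\<forall>x\<in>verts G. \<phi> x \<in> L x"
      using distinct_choice[of "verts G" L] 0 by auto
    moreover have "x \<in> verts G \<and> y \<in> verts G \<and> x \<noteq> y" if "x \<rightarrow>\<^bsub>G\<^esub> y" for x y
      using that adj_in_verts adj_not_same by blast
    ultimately show ?case
      unfolding requester_forces.simps list_colorable_def inj_on_def by metis
  next
    case (Suc n)
    show ?case
    proof (cases "\<exists>x\<in>verts G. card (L x) < card (verts G)")
      case True
      then obtain x where x: "x \<in> verts G" "card (L x) < card (verts G)" by blast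
      have "requester_forces G n (add_color L x c)" if c: "c \<notin> L x" for c
      proof (rule Suc.IH)
        have "(\<Sum>y\<in>verts G. card (verts G) - card (add_color L x c y))
            < (\<Sum>y\<in>verts G. card (verts G) - card (L y))"
          using x c Suc.prems(2) by (intro sum_strict_mono_ex1) (auto simp: add_color_def)
        then show "(\<Sum>y\<in>verts G. card (verts G) - card (add_color L x c y)) \<le> n"
          using Suc.prems(1) by simp
      qed (use Suc.prems(2) in \<open>simp add: add_color_def\<close>)
      then show ?thesis using x by auto
    next
      case False
      then have "requester_forces G n L"
        using Suc.prems(2) by (intro Suc.IH) (auto simp: not_less)
      then show ?thesis using requester_forces_mono by (metis le_SucI order_refl)
    qed
  qed
  then show ?thesis using assms by blast
qed

lemma (in graph) chi_ISC_eq_iff: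
  "chi_ISC G = n \<longleftrightarrow> requester_forces G n (\<lambda>_. {}) \<and> supplier_forces G n (\<lambda>_. {})"
proof -
  let ?R = "\<lambda>n. requester_forces G n (\<lambda>_. {})"
  let ?S = "\<lambda>n. supplier_forces G n (\<lambda>_. {})"
  have S: "?S (Suc n) \<longleftrightarrow> \<not> ?R n" for n
    by (rule supplier_forces_Suc_iff) simp
  have ex: "\<exists>n. ?R n" by (rule ex_requester_forces) simp
  let ?m = "LEAST n. ?R n"
  have "?R ?m" using ex by (rule LeastI_ex)
  moreover have "?S ?m"
  proof (cases ?m)
    case (Suc k)
    then have "\<not> ?R k" using not_less_Least[of k ?R] by simp
    then show ?thesis using Suc S by metis
  qed simp
  moreover have "m = k" if "?R m" "?S m" "?R k" "?S k" for m k
  proof -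
    have "a \<le> b" if "?S a" "?R b" for a b
    proof (rule ccontr)
      assume "\<not> a \<le> b"
      then obtain j where j: "a = Suc j" "b \<le> j" by (cases a) auto
      then show False using S requester_forces_mono that by blast
    qed
    then show ?thesis using that by (meson le_antisym)
  qed
  ultimately have "\<exists>!n. ?R n \<and> ?S n" by blast
  then show ?thesis
    unfolding chi_ISC_def by (metis (mono_tags, lifting) theI')
qed

subsection \<open>Triangular numbers\<close>

definition tri :: "nat \<Rightarrow> nat" where
  "tri k = (k + 1) choose 2"

definition triangular :: "nat \<Rightarrow> bool" where
  "triangular n \<longleftrightarrow> (\<exists>k\<ge>1. n = tri k)"

definition tri_index :: "nat \<Rightarrow> nat" where
  "tri_index r = Max {k. tri k \<le> r}"

lemma finite_tri_le: "finite {k. tri k \<le> r}"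
proof (rule finite_subset)
  have "k \<le> tri k" for k
    by (induction k) (auto simp: tri_def numeral_2_eq_2)
  then show "{k. tri k \<le> r} \<subseteq> {..r}" using order_trans by auto
qed simp

end

theory Submission
  imports Defs
begin

text \<open>
  Let \<open>v\<close> be the stem, \<open>R\<close> its leaves and \<open>D\<close> the set of its other neighbors, which has at most
  one element.  Suppose that every leaf has one color.  If \<open>v\<close> is to be colored \<open>c\<close>, then the leaves
  with list \<open>{c}\<close> must be requested again; the number of these leaves is the price of \<open>c\<close>.  The
  prices sum to \<open>r\<close>, and repeated requests at \<open>v\<close> let Requester choose among ever more colors.

  Supplier gives the leaves colors of prices \<open>u, u - 1, \<dots>, 1\<close>, of sum \<open>t\<^sub>u\<close>, and plays optimally on
  \<open>T - R - v\<close>; in the triangular case the prices are \<open>u + 1, u, \<dots>, 2\<close>, of sum \<open>t\<^sub>u\<^sub>+\<^sub>1 - 1\<close>, and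
  the first \<open>u\<close> requests at \<open>v\<close> are kept apart from an optimal game on \<open>T - R\<close>.

  Requester first requests every leaf.  When \<open>r + 1\<close> is not triangular, he requests \<open>v\<close> until a
  color \<open>c\<close> fits into the budget, and then plays on \<open>T - R - v\<close>: if one round is left over he lets
  the vertex in \<open>D\<close> avoid \<open>c\<close>; otherwise he only needs another color at \<open>v\<close> if \<open>D\<close> ends up with
  color \<open>c\<close>.  When \<open>r + 1\<close> is triangular, he plays on \<open>T - R\<close> but ignores the answers at \<open>v\<close> until
  one fits into the budget.  In all cases, running out of budget would mean that the prices seen
  exceed \<open>r\<close>.
\<close>

section \<open>The game on an arbitrary graph\<close>

definition list_coloring :: "('a,'b) pre_digraph \<Rightarrow> ('a \<Rightarrow> nat set) \<Rightarrow> ('a \<Rightarrow> nat) \<Rightarrow> bool" where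
  "list_coloring G L \<phi> \<longleftrightarrow> (\<forall>x\<in>verts G. \<phi> x \<in> L x) \<and> (\<forall>x y. x \<rightarrow>\<^bsub>G\<^esub> y \<longrightarrow> \<phi> x \<noteq> \<phi> y)"

lemma list_colorable_iff: "list_colorable G L \<longleftrightarrow> (\<exists>\<phi>. list_coloring G L \<phi>)"
  by (simp add: list_colorable_def list_coloring_def)

lemma list_coloring_mono:
  "list_coloring G L \<phi> \<Longrightarrow> (\<And>x. x \<in> verts G \<Longrightarrow> L x \<subseteq> L' x) \<Longrightarrow> list_coloring G L' \<phi>"
  unfolding list_coloring_def by blast

lemma list_colorable_cong:
  "(\<And>x. x \<in> verts G \<Longrightarrow> L x = L' x) \<Longrightarrow> list_colorable G L \<longleftrightarrow> list_colorable G L'"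
  unfolding list_colorable_def by simp

lemma add_color_same [simp]: "add_color L x c x = insert c (L x)"
  and add_color_other [simp]: "y \<noteq> x \<Longrightarrow> add_color L x c y = L y"
  by (simp_all add: add_color_def)

lemma add_color_mono: "L y \<subseteq> add_color L x c y"
  by (auto simp: add_color_def)

lemma finite_add_color [simp]: "finite (add_color L x c y) \<longleftrightarrow> finite (L y)"
  by (cases "y = x") simp_all

lemma requester_forces_colorable: "list_colorable G L \<Longrightarrow> requester_forces G n L"
  by (cases n) auto

lemma requester_forces_ask:
  assumes "x \<in> verts G" "\<And>c. c \<notin> L x \<Longrightarrow> requester_forces G n (add_color L x c)"
  shows "requester_forces G (Suc n) L"
  using assms by auto

lemma requester_forces_cong:
  assumes "\<And>x. x \<in> verts G \<Longrightarrow> L x = L' x"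
  shows "requester_forces G n L \<longleftrightarrow> requester_forces G n L'"
  using assms
proof (induction n arbitrary: L L')
  case 0
  then show ?case
    using list_colorable_cong[of G L L'] by simp
next
  case (Suc n)
  have "requester_forces G n (add_color L x c) \<longleftrightarrow> requester_forces G n (add_color L' x c)" for x c
    using Suc.prems by (intro Suc.IH) (auto simp: add_color_def)
  then show ?case
    using Suc.prems list_colorable_cong[of G L L'] by simp
qed

lemma supplier_forces_cong:
  assumes "\<And>x. x \<in> verts G \<Longrightarrow> L x = L' x"
  shows "supplier_forces G n L \<longleftrightarrow> supplier_forces G n L'"
  using assms
proof (induction n arbitrary: L L')
  case (Suc n)
  have "supplier_forces G n (add_color L x c) \<longleftrightarrow> supplier_forces G n (add_color L' x c)" for x c
    using Suc.prems by (intro Suc.IH) (auto simp: add_color_def)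
  then show ?case
    using Suc.prems list_colorable_cong[of G L L'] by simp
qed simp

lemma supplier_forces_imp_not_requester_forces:
  assumes "supplier_forces G m L" "n < m" "\<And>x. finite (L x)"
  shows "\<not> requester_forces G n L"
proof -
  obtain k where k: "m = Suc k" "n \<le> k"
    using assms(2) by (cases m) auto
  then show ?thesis
    using assms supplier_forces_Suc_iff[of L G k] requester_forces_mono by blast
qed

lemma (in graph) chi_ISC_leI:
  assumes "requester_forces G n (\<lambda>_. {})"
  shows "chi_ISC G \<le> n"
proof (rule ccontr)
  assume "\<not> chi_ISC G \<le> n"
  moreover have "supplier_forces G (chi_ISC G) (\<lambda>_. {})"
    using chi_ISC_eq_iff by blast
  ultimately show False
    using supplier_forces_imp_not_requester_forces[of G "chi_ISC G" "\<lambda>_. {}" n] assms by auto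
qed

lemma (in graph) chi_ISC_geI:
  assumes "supplier_forces G n (\<lambda>_. {})"
  shows "n \<le> chi_ISC G"
proof (rule ccontr)
  assume "\<not> n \<le> chi_ISC G"
  moreover have "requester_forces G (chi_ISC G) (\<lambda>_. {})"
    using chi_ISC_eq_iff by blast
  ultimately show False
    using supplier_forces_imp_not_requester_forces[of G n "\<lambda>_. {}" "chi_ISC G"] assms by auto
qed

text \<open>Lets a block of requests be judged at its end: the last hypothesis ranges over all
  positions that one answer per vertex of \<open>A\<close> can produce.\<close>

lemma requester_forces_ask_each:
  assumes "finite A" "A \<subseteq> verts G"
    and "\<And>L'. (\<And>x. x \<notin> A \<Longrightarrow> L' x = L x) \<Longrightarrow>
           (\<And>x. x \<in> A \<Longrightarrow> \<exists>c. c \<notin> L x \<and> L' x = insert c (L x)) \<Longrightarrow> requester_forces G n L'"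
  shows "requester_forces G (card A + n) L"
  using assms
proof (induction A arbitrary: L rule: finite_induct)
  case empty
  then show ?case by simp
next
  case (insert a A)
  have "requester_forces G (card A + n) (add_color L a c)" if c: "c \<notin> L a" for c
  proof (rule insert.IH)
    fix L'
    assume L': "\<And>x. x \<notin> A \<Longrightarrow> L' x = add_color L a c x"
      "\<And>x. x \<in> A \<Longrightarrow> \<exists>d. d \<notin> add_color L a c x \<and> L' x = insert d (add_color L a c x)"
    show "requester_forces G n L'"
    proof (rule insert.prems(2))
      show "L' x = L x" if "x \<notin> insert a A" for x
        using that L'(1)[of x] by simp
      show "\<exists>d. d \<notin> L x \<and> L' x = insert d (L x)" if "x \<in> insert a A" for x
        using that L'(1)[of x] L'(2)[of x] c insert.hyps by (cases "x = a") auto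
    qed
  qed (use insert.prems in auto)
  then have "requester_forces G (Suc (card A + n)) L"
    using insert.prems by (intro requester_forces_ask[of a]) auto
  then show ?case
    using insert.hyps by simp
qed

text \<open>Requester follows on \<open>G\<close> a strategy for \<open>H\<close> in which the colors of \<open>J x\<close> count as absent
  from the list of \<open>x\<close>; each answer in \<open>J x\<close> wastes one round.\<close>

lemma requester_forces_transfer:
  assumes "verts H \<subseteq> verts G" "finite (verts H)" "\<And>x. finite (J x)"
    and "requester_forces H m (\<lambda>x. L x - J x)"
    and "\<And>L'. (\<And>x. x \<notin> verts H \<Longrightarrow> L' x = L x) \<Longrightarrow> (\<And>x. L x \<subseteq> L' x) \<Longrightarrow>
           list_colorable H (\<lambda>x. L' x - J x) \<Longrightarrow> requester_forces G k L'"
  shows "requester_forces G (m + k + (\<Sum>x\<in>verts H. card (J x - L x))) L"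
  using assms(4,5)
\<comment> \<open>Every answer lowers one summand: outside \<open>J x\<close> it lowers
  \<open>m\<close>, inside \<open>J x\<close> it lowers the number of absent colors still to
  come.\<close>
proof (induction "m + (\<Sum>x\<in>verts H. card (J x - L x))" arbitrary: m L)
  case 0
  then show ?case by simp
next
  case (Suc N)
  let ?w = "\<lambda>L. \<Sum>x\<in>verts H. card (J x - L x)"
  show ?case
  proof (cases "list_colorable H (\<lambda>x. L x - J x)")
    case True
    then have "requester_forces G k L"
      using Suc.prems(2) by simp
    then show ?thesis
      by (rule requester_forces_mono) simp
  next
    case False
    then obtain m' where m': "m = Suc m'"
      using Suc.prems(1) by (cases m) auto
    obtain x where x: "x \<in> verts H"
      "\<And>c. c \<notin> L x - J x \<Longrightarrow> requester_forces H m' (add_color (\<lambda>x. L x - J x) x c)"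
      using Suc.prems(1) False m' by auto
    have "requester_forces G (m' + k + ?w L) (add_color L x c)" if c: "c \<notin> L x" for c
    proof -
      have colorable: "requester_forces G k L'"
        if "\<And>y. y \<notin> verts H \<Longrightarrow> L' y = add_color L x c y" "\<And>y. add_color L x c y \<subseteq> L' y"
          "list_colorable H (\<lambda>x. L' x - J x)" for L'
      proof (rule Suc.prems(2)[OF _ _ that(3)])
        show "L' y = L y" if "y \<notin> verts H" for y
          using that \<open>\<And>y. y \<notin> verts H \<Longrightarrow> L' y = add_color L x c y\<close> x(1) by (cases "y = x") auto
        show "L y \<subseteq> L' y" for y
          using that(2)[of y] add_color_mono[of L y x c] by blast
      qed
      show ?thesis
      proof (cases "c \<in> J x")
        case True
        have "card (J x - insert c (L x)) < card (J x - L x)"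
          using True c assms(3) by (intro psubset_card_mono) auto
        then have "Suc (card (J x - insert c (L x))) = card (J x - L x)"
          using True c assms(3)[of x]
          by (metis DiffI Diff_insert card_Suc_Diff1 finite_Diff)
        then have w: "Suc (?w (add_color L x c)) = ?w L"
          using sum.remove[OF assms(2) x(1), of "\<lambda>y. card (J y - L y)"]
            sum.remove[OF assms(2) x(1), of "\<lambda>y. card (J y - add_color L x c y)"]
          by simp
        have "(\<lambda>y. add_color L x c y - J y) = (\<lambda>y. L y - J y)"
          using True by (auto simp: add_color_def fun_eq_iff)
        then have "requester_forces G (m + k + ?w (add_color L x c)) (add_color L x c)"
          using w Suc.hyps(2) Suc.prems(1) by (intro Suc.hyps(1) colorable) auto
        moreover have "m + k + ?w (add_color L x c) = m' + k + ?w L"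
          using w m' by simp
        ultimately show ?thesis by metis
      next
        case False
        have "J x - insert c (L x) = J x - L x"
          using False by auto
        then have w: "?w (add_color L x c) = ?w L"
          by (intro sum.cong) (auto simp: add_color_def)
        have "add_color (\<lambda>x. L x - J x) x c = (\<lambda>y. add_color L x c y - J y)"
          using False by (auto simp: add_color_def fun_eq_iff)
        then have "requester_forces G (m' + k + ?w (add_color L x c)) (add_color L x c)"
          using w Suc.hyps(2) x(2)[of c] c m' by (intro Suc.hyps(1) colorable) auto
        then show ?thesis using w by simp
      qed
    qed
    then have "requester_forces G (Suc (m' + k + ?w L)) L"
      using x(1) assms(1) by (intro requester_forces_ask[of x]) auto
    then show ?thesis using m' by simp
  qed
qed

text \<open>As long as the lists hold fewer colors in total than there are vertices, some list is
  empty, so any fresh answer keeps the game going.\<close>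

lemma supplier_forces_card:
  assumes "finite (verts G)" "\<And>x. finite (L x)"
    and "n + (\<Sum>x\<in>verts G. card (L x)) \<le> card (verts G)"
  shows "supplier_forces G n L"
  using assms(2,3)
proof (induction n arbitrary: L)
  case (Suc n)
  have "\<not> list_colorable G L"
  proof
    assume "list_colorable G L"
    then have "\<forall>x\<in>verts G. L x \<noteq> {}"
      unfolding list_colorable_def by blast
    then have "(\<Sum>x\<in>verts G. 1) \<le> (\<Sum>x\<in>verts G. card (L x))"
      using Suc.prems(1) by (intro sum_mono) (simp add: Suc_leI card_gt_0_iff)
    then show False using Suc.prems(2) by simp
  qed
  moreover have "\<exists>c. c \<notin> L x \<and> supplier_forces G n (add_color L x c)" if "x \<in> verts G" for x
  proof -
    obtain c where c: "c \<notin> L x"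
      using Suc.prems(1) ex_new_if_finite infinite_UNIV_nat by blast
    have "(\<Sum>y\<in>verts G. card (add_color L x c y)) = Suc (\<Sum>y\<in>verts G. card (L y))"
      using sum.remove[OF assms(1) that, of "\<lambda>y. card (L y)"]
        sum.remove[OF assms(1) that, of "\<lambda>y. card (add_color L x c y)"] c Suc.prems(1)
      by simp
    then show ?thesis
      using c Suc.prems by (intro exI[of _ c] conjI Suc.IH) auto
  qed
  ultimately show ?case by simp
qed simp

lemma (in graph) chi_ISC_edgeless:
  assumes "arcs G = {}"
  shows "chi_ISC G = card (verts G)"
proof (rule antisym)
  have "requester_forces G 0 L" if "\<And>x. x \<in> verts G \<Longrightarrow> \<exists>c. L x = {c}" for L
  proof -
    have "\<forall>x\<in>verts G. (SOME c. c \<in> L x) \<in> L x"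
      using that by (metis singletonI someI)
    then show ?thesis
      using assms by (auto simp: list_colorable_def arcs_ends_def)
  qed
  then have "requester_forces G (card (verts G) + 0) (\<lambda>_. {})"
    by (intro requester_forces_ask_each) auto
  then show "chi_ISC G \<le> card (verts G)"
    by (intro chi_ISC_leI) simp
  show "card (verts G) \<le> chi_ISC G"
    by (intro chi_ISC_geI supplier_forces_card) auto
qed

section \<open>Triangular numbers\<close>

lemma tri_0 [simp]: "tri 0 = 0"
  and tri_Suc [simp]: "tri (Suc k) = tri k + Suc k"
  by (simp_all add: tri_def numeral_2_eq_2)

lemma tri_index_bounds: "tri (tri_index r) \<le> r" "r < tri (Suc (tri_index r))"
proof -
  have "{k. tri k \<le> r} \<noteq> {}"
    by (auto intro: exI[of _ 0])
  then have "tri_index r \<in> {k. tri k \<le> r}"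
    unfolding tri_index_def using finite_tri_le by (intro Max_in)
  then show "tri (tri_index r) \<le> r" by simp
  show "r < tri (Suc (tri_index r))"
  proof (rule ccontr)
    assume "\<not> r < tri (Suc (tri_index r))"
    then have "Suc (tri_index r) \<le> tri_index r"
      unfolding tri_index_def using finite_tri_le by (intro Max_ge) (auto simp: tri_index_def)
    then show False by simp
  qed
qed

lemma strict_mono_tri: "strict_mono tri"
  by (rule strict_mono_Suc_iff[THEN iffD2]) simp

text \<open>By \<open>tri_index_bounds\<close>, \<open>tri (Suc (tri_index r))\<close> is the least
  triangular number above \<open>r\<close> and so the only one that \<open>r + 1\<close> can
  equal.\<close>

lemma triangular_Suc_iff: "triangular (r + 1) \<longleftrightarrow> r + 1 = tri (Suc (tri_index r))"
proof
  assume "triangular (r + 1)"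
  then obtain k where k: "r + 1 = tri k"
    unfolding triangular_def by blast
  then have "tri (tri_index r) < tri k" "tri k \<le> tri (Suc (tri_index r))"
    using tri_index_bounds[of r] by simp_all
  then have "tri_index r < k" "k \<le> Suc (tri_index r)"
    using strict_mono_less[OF strict_mono_tri] strict_mono_less_eq[OF strict_mono_tri] by blast+
  then have "k = Suc (tri_index r)" by simp
  with k show "r + 1 = tri (Suc (tri_index r))" by simp
next
  assume "r + 1 = tri (Suc (tri_index r))"
  then show "triangular (r + 1)"
    unfolding triangular_def by (intro exI[of _ "Suc (tri_index r)"]) auto
qed

lemma sum_countdown: "(\<Sum>i<u. u - i) = tri u"
proof (induction u)
  case (Suc u)
  then show ?case
    by (simp add: sum.lessThan_Suc_shift del: sum.lessThan_Suc)
qed simp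

lemma sum_countdown_Suc: "Suc (\<Sum>i<u. Suc u - i) = tri (Suc u)"
proof -
  have "(\<Sum>i<Suc u. Suc u - i) = tri (Suc u)"
    by (rule sum_countdown)
  then show ?thesis by (simp add: sum.lessThan_Suc)
qed

text \<open>Disjoint blocks of sizes \<open>a i\<close> fit into \<open>R\<close>; surplus elements
  may get any value. Supplier uses \<open>g\<close> to plan the first colors of the leaves.\<close>

lemma ex_fibers_ge:
  fixes a :: "nat \<Rightarrow> nat"
  assumes "finite R" "(\<Sum>i<u. a i) \<le> card R"
  shows "\<exists>g. \<forall>i<u. a i \<le> card {x\<in>R. g x = i}"
  using assms
proof (induction u arbitrary: R)
  case (Suc u)
  then obtain S where S: "S \<subseteq> R" "card S = a u"
    by (metis add_leD2 obtain_subset_with_card_n sum.lessThan_Suc)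
  then have "card (R - S) = card R - a u" "finite (R - S)"
    using Suc.prems(1) by (simp_all add: card_Diff_subset finite_subset)
  moreover from this have "(\<Sum>i<u. a i) \<le> card (R - S)"
    using Suc.prems(2) by simp
  ultimately obtain g where g: "\<forall>i<u. a i \<le> card {x\<in>R - S. g x = i}"
    using Suc.IH[of "R - S"] by blast
  let ?g = "\<lambda>x. if x \<in> S then u else g x"
  have "a i \<le> card {x\<in>R. ?g x = i}" if "i < Suc u" for i
  proof (cases "i = u")
    case True
    have "card S \<le> card {x\<in>R. ?g x = i}"
      using S Suc.prems(1) True by (intro card_mono) auto
    then show ?thesis using S True by simp
  next
    case False
    then have "a i \<le> card {x\<in>R - S. g x = i}"
      using g that by simp
    also have "\<dots> \<le> card {x\<in>R. ?g x = i}"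
      using Suc.prems(1) by (intro card_mono) auto
    finally show ?thesis .
  qed
  then show ?case by (intro exI[of _ ?g]) blast
qed simp

section \<open>A vertex with pendant leaves\<close>

lemma (in wf_digraph) dominates_delete_verts_iff:
  "x \<rightarrow>\<^bsub>delete_verts G S\<^esub> y \<longleftrightarrow> x \<rightarrow>\<^bsub>G\<^esub> y \<and> x \<notin> S \<and> y \<notin> S"
  by (auto simp: delete_verts_def arcs_ends_conv)

lemma verts_delete_verts [simp]: "verts (delete_verts G S) = verts G - S"
  by (simp add: delete_verts_def)

lemma (in graph) graph_delete_verts: "graph (delete_verts G S)"
proof -
  have "digraph (delete_verts G S)"
    unfolding delete_verts_def
    by (intro digraph_subgraph induced_imp_subgraph induced_induce) auto
  then interpret D: digraph "delete_verts G S" .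
  have "symmetric (delete_verts G S)"
    using arcs_ends_symmetric[OF sym_arcs]
    by (auto simp: symmetric_def sym_def dominates_delete_verts_iff)
  then show ?thesis
    by unfold_locales
qed

text \<open>The price of \<open>c\<close> when \<open>g\<close> gives the first color of each
  leaf.\<close>

definition fiber :: "'a set \<Rightarrow> ('a \<Rightarrow> nat) \<Rightarrow> nat \<Rightarrow> nat" where
  "fiber R g c = card {x\<in>R. g x = c}"

text \<open>The total price of the colors outside \<open>X\<close>. With \<open>X\<close> the list
  of \<open>v\<close>, it bounds the joint price of all answers still to come at
  \<open>v\<close>.\<close>

definition missed :: "'a set \<Rightarrow> ('a \<Rightarrow> nat) \<Rightarrow> nat set \<Rightarrow> nat" where
  "missed R g X = card {x\<in>R. g x \<notin> X}"

lemma missed_empty [simp]: "missed R g {} = card R"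
  by (simp add: missed_def)

lemma missed_insert:
  assumes "finite R" "c \<notin> X"
  shows "missed R g (insert c X) + fiber R g c = missed R g X"
proof -
  have "{x\<in>R. g x \<notin> X} = {x\<in>R. g x \<notin> insert c X} \<union> {x\<in>R. g x = c}"
    using assms(2) by auto
  moreover have "card ({x\<in>R. g x \<notin> insert c X} \<union> {x\<in>R. g x = c})
      = card {x\<in>R. g x \<notin> insert c X} + card {x\<in>R. g x = c}"
    using assms(1) by (intro card_Un_disjoint) auto
  ultimately show ?thesis
    unfolding missed_def fiber_def by presburger
qed

lemma missed_antimono: "finite R \<Longrightarrow> X \<subseteq> Y \<Longrightarrow> missed R g Y \<le> missed R g X"
  unfolding missed_def by (intro card_mono) auto

text \<open>The surroundings of a stem. \<open>D_unique\<close> is pointwise, so that it covers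
  \<open>D = {}\<close>, where the component of \<open>v\<close> is a star; it means that a coloring
  of \<open>rest\<close> blocks at most one color at \<open>v\<close>.\<close>

locale pendant_star = graph +
  fixes v :: 'a and R D :: "'a set"
  assumes v_in_verts: "v \<in> verts G" and R_subset: "R \<subseteq> verts G" and v_notin_R: "v \<notin> R"
    and dominates_v: "v \<rightarrow>\<^bsub>G\<^esub> y \<longleftrightarrow> y \<in> R \<union> D"
    and dominates_leaf: "x \<in> R \<Longrightarrow> x \<rightarrow>\<^bsub>G\<^esub> y \<longleftrightarrow> y = v"
    and R_D_disjoint: "R \<inter> D = {}"
    and D_unique: "p \<in> D \<Longrightarrow> q \<in> D \<Longrightarrow> p = q"
begin

abbreviation "rest \<equiv> delete_verts G (R \<union> {v})"

abbreviation "trunk \<equiv> delete_verts G R"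

lemma finite_R: "finite R"
  using R_subset finite_verts finite_subset by blast

lemma D_subset: "D \<subseteq> verts rest"
  using dominates_v adj_in_verts adj_not_same R_D_disjoint by fastforce

lemma dominates_v': "y \<rightarrow>\<^bsub>G\<^esub> v \<longleftrightarrow> y \<in> R \<union> D"
  using dominates_v arcs_ends_symmetric[OF sym_arcs] by blast

lemma dominates_leaf': "x \<in> R \<Longrightarrow> y \<rightarrow>\<^bsub>G\<^esub> x \<longleftrightarrow> y = v"
  using dominates_leaf arcs_ends_symmetric[OF sym_arcs] by blast

lemma list_coloring_rest_if_trunk:
  assumes "list_coloring trunk L \<phi>"
  shows "list_coloring rest L \<phi>"
  using assms by (auto simp: list_coloring_def dominates_delete_verts_iff)

lemma list_coloring_trunk_extend:
  assumes "list_coloring rest L \<phi>" "c \<in> L v" "c \<notin> \<phi> ` D"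
  shows "list_coloring trunk L (\<phi>(v := c))"
  using assms dominates_v dominates_v' adj_not_same v_notin_R R_D_disjoint
  by (auto simp: list_coloring_def dominates_delete_verts_iff)

text \<open>A leaf is constrained by \<open>v\<close> only, so any color other than \<open>c\<close>
  serves there.\<close>

lemma list_colorable_extend:
  assumes "list_coloring rest L \<phi>" "c \<in> L v" "c \<notin> \<phi> ` D"
    and "\<And>x. x \<in> R \<Longrightarrow> \<exists>d. d \<in> L x \<and> d \<noteq> c"
  shows "list_colorable G L"
proof -
  obtain f where f: "\<And>x. x \<in> R \<Longrightarrow> f x \<in> L x \<and> f x \<noteq> c"
    using assms(4) by metis
  have trunk: "list_coloring trunk L (\<phi>(v := c))"
    using assms by (intro list_coloring_trunk_extend)
  let ?\<psi> = "\<lambda>x. if x \<in> R then f x else (\<phi>(v := c)) x"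
  have "?\<psi> x \<noteq> ?\<psi> y" if "x \<rightarrow>\<^bsub>G\<^esub> y" for x y
  proof (cases "x \<in> R \<or> y \<in> R")
    case True
    then show ?thesis
      using that f v_notin_R dominates_leaf dominates_leaf' by force
  next
    case False
    then show ?thesis
      using that trunk unfolding list_coloring_def dominates_delete_verts_iff by auto
  qed
  moreover have "?\<psi> x \<in> L x" if "x \<in> verts G" for x
    using that trunk f by (simp add: list_coloring_def)
  ultimately show ?thesis
    unfolding list_colorable_def by (intro exI[of _ ?\<psi>]) simp
qed

subsection \<open>Requester's strategies\<close>

text \<open>Only leaves whose sole color is \<open>c\<close> stand in the way. A second answer there
  must be new, hence differs from \<open>c\<close>.\<close>

lemma requester_finishes:
  assumes "list_coloring rest L \<phi>" "c \<in> L v" "c \<notin> \<phi> ` D"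
    and leaves: "\<And>x. x \<in> R \<Longrightarrow> L x = {g x}" and "fiber R g c \<le> n"
  shows "requester_forces G n L"
proof -
  let ?A = "{x\<in>R. g x = c}"
  have "requester_forces G (card ?A + 0) L"
  proof (rule requester_forces_ask_each)
    fix L'
    assume L': "\<And>x. x \<notin> ?A \<Longrightarrow> L' x = L x"
      "\<And>x. x \<in> ?A \<Longrightarrow> \<exists>d. d \<notin> L x \<and> L' x = insert d (L x)"
    have "list_colorable G L'"
    proof (rule list_colorable_extend)
      have "L' x = L x" if "x \<notin> R" for x
        using that L'(1)[of x] by simp
      then show "list_coloring rest L' \<phi>" "c \<in> L' v"
        using list_coloring_mono[OF assms(1), of L'] assms(2) v_notin_R by auto
      show "\<exists>d. d \<in> L' x \<and> d \<noteq> c" if "x \<in> R" for x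
        using that L'(1)[of x] L'(2)[of x] leaves[of x] by (cases "x \<in> ?A") auto
    qed (fact assms(3))
    then show "requester_forces G 0 L'" by simp
  qed (use finite_R R_subset in auto)
  then show ?thesis
    using assms(5) by (auto simp: fiber_def elim: requester_forces_mono)
qed

text \<open>Colors at \<open>v\<close> worth more than the remaining budget would use up more than all leaves.\<close>

lemma requester_asks_v:
  assumes "list_coloring rest L \<phi>" "\<phi> ` D \<subseteq> L v"
    and "\<And>x. x \<in> R \<Longrightarrow> L x = {g x}" and "missed R g (L v) < tri k"
  shows "requester_forces G k L"
  using assms
proof (induction k arbitrary: L)
  case 0
  then show ?case by simp
next
  case (Suc k)
  show ?case
  proof (rule requester_forces_ask[OF v_in_verts])
    fix c assume c: "c \<notin> L v"
    have coloring: "list_coloring rest (add_color L v c) \<phi>"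
      using Suc.prems(1) by (rule list_coloring_mono) (rule add_color_mono)
    have leaves: "add_color L v c x = {g x}" if "x \<in> R" for x
      using that Suc.prems(3) v_notin_R by (metis add_color_other)
    show "requester_forces G k (add_color L v c)"
    proof (cases "fiber R g c \<le> k")
      case True
      then show ?thesis
        using coloring c Suc.prems(2) leaves
        by (intro requester_finishes[of _ \<phi> c]) auto
    next
      \<comment> \<open>The price is at least \<open>Suc k\<close>, the gap between
        \<open>tri (Suc k)\<close> and \<open>tri k\<close>.\<close>
      case False
      then have "missed R g (add_color L v c v) < tri k"
        using missed_insert[OF finite_R c, of g] Suc.prems(4) by simp
      then show ?thesis
        using coloring leaves Suc.prems(2) by (intro Suc.IH) auto
    qed
  qed
qed

text \<open>Treating \<open>c\<close> as absent at the vertex of \<open>D\<close> wastes at most one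
  round, whence the \<open>+ 1\<close>; afterwards \<open>v\<close> can take \<open>c\<close>, whose
  price fits into \<open>k\<close>.\<close>

lemma requester_avoiding_color:
  assumes "requester_forces rest m L" "\<And>x. x \<in> verts rest \<Longrightarrow> L x = {}" "c \<in> L v"
    and leaves: "\<And>x. x \<in> R \<Longrightarrow> L x = {g x}" and "fiber R g c \<le> k"
  shows "requester_forces G (m + k + 1) L"
proof -
  let ?J = "\<lambda>x. if x \<in> D then {c} else {}"
  have "requester_forces G (m + k + (\<Sum>x\<in>verts rest. card (?J x - L x))) L"
  proof (rule requester_forces_transfer)
    \<comment> \<open>The lists on \<open>rest\<close> are still empty, so removing \<open>c\<close>
      leaves the position as it is.\<close>
    have "L x - ?J x = L x" for x
      using assms(2) D_subset by (cases "x \<in> D") auto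
    then show "requester_forces rest m (\<lambda>x. L x - ?J x)"
      using assms(1) by simp
    fix L'
    assume L': "\<And>x. x \<notin> verts rest \<Longrightarrow> L' x = L x"
      "list_colorable rest (\<lambda>x. L' x - ?J x)"
    then obtain \<phi> where \<phi>: "list_coloring rest (\<lambda>x. L' x - ?J x) \<phi>"
      by (auto simp: list_colorable_iff)
    have "\<phi> p \<noteq> c" if "p \<in> D" for p
    proof -
      have "\<phi> p \<in> L' p - ?J p"
        using \<phi> that D_subset unfolding list_coloring_def by blast
      then show ?thesis using that by simp
    qed
    then have "c \<notin> \<phi> ` D" by blast
    moreover have "list_coloring rest L' \<phi>"
      using \<phi> by (rule list_coloring_mono) auto
    ultimately show "requester_forces G k L'"
      using assms L'(1) by (intro requester_finishes[of L' \<phi> c g]) auto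
  qed auto
  moreover have "(\<Sum>x\<in>verts rest. card (?J x - L x)) \<le> 1"
  proof -
    have "(\<Sum>x\<in>verts rest. card (?J x - L x)) \<le> (\<Sum>x\<in>verts rest. if x \<in> D then 1 else 0)"
      using assms(2) by (intro sum_mono) auto
    also have "\<dots> = card D"
      using D_subset by (simp add: sum.If_cases Int_absorb1)
    also have "card D \<le> 1"
      using D_unique finite_subset[OF D_subset] by (simp add: card_le_Suc0_iff_eq)
    finally show ?thesis .
  qed
  ultimately show ?thesis
    by (elim requester_forces_mono) simp
qed

text \<open>The budget \<open>k\<close> pays for requests at \<open>v\<close> and second requests at
  leaves. An answer at \<open>v\<close> is too expensive, fits exactly, or leaves a spare round for
  keeping \<open>D\<close> away from it. The \<open>+ 1\<close> in the bound on
  \<open>missed\<close> is what the exact fit consumes.\<close>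

lemma requester_star_first:
  assumes "requester_forces rest m L" "\<And>x. x \<in> verts rest \<Longrightarrow> L x = {}"
    and "\<And>x. x \<in> R \<Longrightarrow> L x = {g x}" and "missed R g (L v) + 1 < tri k"
  shows "requester_forces G (m + k) L"
  using assms
proof (induction k arbitrary: L)
  case 0
  then show ?case by simp
next
  case (Suc k)
  have "requester_forces G (m + k) (add_color L v c)" if c: "c \<notin> L v" for c
  proof -
    let ?L = "add_color L v c"
    have eq: "?L x = L x" if "x \<noteq> v" for x
      using that by simp
    have rest: "requester_forces rest m ?L"
      using Suc.prems(1) requester_forces_cong[of rest ?L L m] by simp
    have empty: "?L x = {}" if "x \<in> verts rest" for x
      using that Suc.prems(2)[of x] by simp
    have leaves: "?L x = {g x}" if "x \<in> R" for x
      using that Suc.prems(3) v_notin_R by (metis add_color_other)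
    have missed: "missed R g (?L v) + fiber R g c = missed R g (L v)"
      using missed_insert[OF finite_R c] by simp
    consider "Suc k \<le> fiber R g c" | "fiber R g c = k" | "fiber R g c < k"
      by linarith
    then show ?thesis
    proof cases
      case 1
      then show ?thesis
        using rest empty leaves missed Suc.prems(4) by (intro Suc.IH) auto
    next
      case 2
      \<comment> \<open>With nothing counted as absent, Requester plays on \<open>rest\<close> and
        holds \<open>c\<close> in reserve.\<close>
      have "requester_forces G (m + k + (\<Sum>x\<in>verts rest. card ({} - ?L x))) ?L"
      proof (rule requester_forces_transfer)
        fix L'
        assume L': "\<And>x. x \<notin> verts rest \<Longrightarrow> L' x = ?L x" "list_colorable rest (\<lambda>x. L' x - {})"
        then obtain \<phi> where \<phi>: "list_coloring rest L' \<phi>"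
          by (auto simp: list_colorable_iff)
        have leaves': "L' x = {g x}" if "x \<in> R" for x
          using that L'(1) leaves by simp
        have v: "L' v = ?L v"
          using L'(1) by simp
        show "requester_forces G k L'"
        proof (cases "c \<in> \<phi> ` D")
          case False
          then show ?thesis
            using \<phi> leaves' v 2 by (intro requester_finishes[of L' \<phi> c g]) auto
        next
          case True
          \<comment> \<open>\<open>D\<close> has at most one vertex, so its color is
            \<open>c\<close>, and later answers at \<open>v\<close> differ from it.\<close>
          then have "\<phi> ` D \<subseteq> L' v"
            using D_unique v by auto
          \<comment> \<open>The price \<open>k\<close> falls short of \<open>Suc k\<close> by one,
            which the \<open>+ 1\<close> in the hypothesis makes up for.\<close>
          moreover have "missed R g (L' v) < tri k"
            using missed v 2 Suc.prems(4) by simp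
          ultimately show ?thesis
            using \<phi> leaves' by (intro requester_asks_v)
        qed
      qed (use rest in auto)
      then show ?thesis by simp
    next
      case 3
      then obtain k' where k': "k = Suc k'"
        by (cases k) auto
      have "requester_forces G (m + k' + 1) ?L"
        using rest empty leaves 3 k' by (intro requester_avoiding_color) auto
      then show ?thesis using k' by simp
    qed
  qed
  then have "requester_forces G (Suc (m + k)) L"
    by (intro requester_forces_ask[OF v_in_verts])
  then show ?case by simp
qed

lemma requester_after_leaves:
  assumes "\<And>L g. (\<And>x. x \<notin> R \<Longrightarrow> L x = {}) \<Longrightarrow> (\<And>x. x \<in> R \<Longrightarrow> L x = {g x}) \<Longrightarrow>
    requester_forces G n L"
  shows "requester_forces G (card R + n) (\<lambda>_. {})"
proof (rule requester_forces_ask_each[OF finite_R R_subset])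
  fix L' :: "'a \<Rightarrow> nat set"
  assume L': "\<And>x. x \<notin> R \<Longrightarrow> L' x = {}" "\<And>x. x \<in> R \<Longrightarrow> \<exists>c. c \<notin> {} \<and> L' x = insert c {}"
  then obtain g where "\<And>x. x \<in> R \<Longrightarrow> L' x = {g x}"
    by metis
  then show "requester_forces G n L'"
    using assms L'(1) by blast
qed

lemma requester_upper_rest:
  assumes "requester_forces rest m (\<lambda>_. {})" "card R + 1 < tri k"
  shows "requester_forces G (card R + (m + k)) (\<lambda>_. {})"
proof (rule requester_after_leaves)
  fix L :: "'a \<Rightarrow> nat set" and g
  assume L: "\<And>x. x \<notin> R \<Longrightarrow> L x = {}" "\<And>x. x \<in> R \<Longrightarrow> L x = {g x}"
  have "requester_forces rest m L"
    using assms(1) requester_forces_cong[of rest L "\<lambda>_. {}" m] L(1) by simp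
  then show "requester_forces G (m + k) L"
    using L assms(2) v_notin_R by (intro requester_star_first[of m L g]) auto
qed

text \<open>Here \<open>c\<close> is an affordable answer at \<open>v\<close> and \<open>I\<close>
  consists of the answers ignored before it. Requester completes the game on \<open>trunk\<close>
  without \<open>I\<close>; then \<open>v\<close> has two candidates, \<open>c\<close> and its color
  \<open>\<phi> v\<close> in that game.\<close>

lemma requester_trunk_accepted:
  assumes "requester_forces trunk m (\<lambda>x. L x - (if x = v then I else {}))"
    and I: "finite I" "I \<subseteq> L v" and c: "c \<in> L v" "fiber R g c \<le> k"
    and leaves: "\<And>x. x \<in> R \<Longrightarrow> L x = {g x}" and missed: "missed R g I < tri (Suc k)"
  shows "requester_forces G (m + k) L"
proof -
  let ?J = "\<lambda>x. if x = v then I else {}"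
  have "requester_forces G (m + k + (\<Sum>x\<in>verts trunk. card (?J x - L x))) L"
  proof (rule requester_forces_transfer)
    fix L'
    assume L': "\<And>x. x \<notin> verts trunk \<Longrightarrow> L' x = L x" "\<And>x. L x \<subseteq> L' x"
      "list_colorable trunk (\<lambda>x. L' x - ?J x)"
    then obtain \<phi> where \<phi>: "list_coloring trunk (\<lambda>x. L' x - ?J x) \<phi>"
      by (auto simp: list_colorable_iff)
    have rest: "list_coloring rest L' \<phi>"
      using list_coloring_rest_if_trunk[OF \<phi>] by (rule list_coloring_mono) auto
    have leaves': "L' x = {g x}" if "x \<in> R" for x
      using that L'(1) leaves by simp
    have v: "\<phi> v \<in> L' v" "\<phi> v \<notin> I"
      using \<phi> v_in_verts v_notin_R by (auto simp: list_coloring_def split: if_splits)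
    have vD: "\<phi> v \<notin> \<phi> ` D"
      using \<phi> D_subset v_notin_R dominates_v R_D_disjoint
      unfolding list_coloring_def dominates_delete_verts_iff by blast
    consider "c \<notin> \<phi> ` D" | "fiber R g (\<phi> v) \<le> k" | "c \<in> \<phi> ` D" "\<not> fiber R g (\<phi> v) \<le> k"
      by blast
    then show "requester_forces G k L'"
    proof cases
      case 1
      then show ?thesis
        using rest leaves' c L'(2)[of v] by (intro requester_finishes[of L' \<phi> c g]) auto
    next
      case 2
      then show ?thesis
        using rest leaves' v vD by (intro requester_finishes[of L' \<phi> "\<phi> v" g]) auto
    next
      case 3
      have "\<phi> ` D \<subseteq> L' v"
        using 3 c(1) L'(2) D_unique by blast
      \<comment> \<open>The price of \<open>\<phi> v\<close> exceeds \<open>k\<close>, so removing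
        it from the total left by \<open>I\<close> leaves less than \<open>tri k\<close>. As
        \<open>D\<close> carries \<open>c\<close>, further requests at \<open>v\<close>
        succeed.\<close>
      moreover have "missed R g (L' v) \<le> missed R g (insert (\<phi> v) I)"
        using v(1) I(2) L'(2)[of v] by (intro missed_antimono finite_R) auto
      then have "missed R g (L' v) < tri k"
        using 3 missed missed_insert[OF finite_R v(2), of g] by simp
      ultimately show ?thesis
        using rest leaves' by (intro requester_asks_v)
    qed
  qed (use assms(1) I in auto)
  moreover have "(\<Sum>x\<in>verts trunk. card (?J x - L x)) = 0"
    using I(2) by (intro sum.neutral) (simp add: Diff_eq_empty_iff[THEN iffD2])
  ultimately show ?thesis by simp
qed

text \<open>In the imagined game on \<open>trunk\<close> the list of \<open>v\<close> stays empty.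
  An ignored answer has price above \<open>k\<close>, so it costs one round of \<open>k\<close> but
  lowers the bound from \<open>tri (Suc k)\<close> to \<open>tri k\<close>; \<open>m\<close> is
  unchanged.\<close>

lemma requester_trunk_ignoring:
  assumes "requester_forces trunk m (L(v := {}))" "finite (L v)"
    and "\<And>x. x \<in> R \<Longrightarrow> L x = {g x}" and "missed R g (L v) < tri (Suc k)"
  shows "requester_forces G (m + k) L"
  using assms
proof (induction "m + k" arbitrary: m k L rule: less_induct)
  case less
  \<comment> \<open>Since \<open>v\<close> has no color in the imagined game, that game is not over
    and its strategy has a next request.\<close>
  have "\<not> list_colorable trunk (L(v := {}))"
    using v_in_verts v_notin_R by (auto simp: list_colorable_def intro!: bexI[of _ v])
  then obtain m' x where m': "m = Suc m'" and x: "x \<in> verts trunk"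
    "\<And>c. c \<notin> (L(v := {})) x \<Longrightarrow> requester_forces trunk m' (add_color (L(v := {})) x c)"
    using less.prems(1) by (cases m) auto
  have "requester_forces G (m' + k) (add_color L x c)" if c: "c \<notin> L x" for c
  proof -
    let ?L = "add_color L x c"
    have leaves: "?L y = {g y}" if "y \<in> R" for y
      using that less.prems(3) x(1) by (metis DiffE add_color_other verts_delete_verts)
    show ?thesis
    proof (cases "x = v")
      case False
      have "add_color (L(v := {})) x c = ?L(v := {})"
        using False by (auto simp: add_color_def fun_eq_iff)
      then show ?thesis
        using x(2)[of c] c m' leaves False less.prems(2,4) by (intro less.hyps) auto
    next
      case True
      have missed: "missed R g (?L v) + fiber R g c = missed R g (L v)"
        using missed_insert[OF finite_R] c True by simp
      show ?thesis
      proof (cases "fiber R g c \<le> k")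
        case accepted: True
        \<comment> \<open>The ignored answers \<open>L v\<close> become the set \<open>I\<close>,
          and \<open>c\<close> is the first answer passed on.\<close>
        have "add_color (L(v := {})) x c = (\<lambda>y. ?L y - (if y = v then L v else {}))"
          using True c by (auto simp: add_color_def fun_eq_iff)
        then show ?thesis
          using x(2)[of c] c True accepted leaves less.prems(2,4)
          by (intro requester_trunk_accepted[of m' ?L "L v" c g]) auto
      next
        case False
        \<comment> \<open>For \<open>k = 0\<close> the bound says
          \<open>missed R g (L v) = 0\<close>, so \<open>c\<close> would be free of charge.\<close>
        then obtain k' where k': "k = Suc k'"
          using missed less.prems(4) by (cases k) auto
        have "?L(v := {}) = L(v := {})"
          using True by (auto simp: add_color_def)
        then have "requester_forces G (m + k') ?L"
          using less.prems False missed leaves True k' by (intro less.hyps) auto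
        then show ?thesis using m' k' by simp
      qed
    qed
  qed
  then have "requester_forces G (Suc (m' + k)) L"
    using x(1) by (intro requester_forces_ask[of x]) auto
  then show ?case using m' by simp
qed

lemma requester_upper_trunk:
  assumes "requester_forces trunk m (\<lambda>_. {})" "card R < tri (Suc k)"
  shows "requester_forces G (card R + (m + k)) (\<lambda>_. {})"
proof (rule requester_after_leaves)
  fix L :: "'a \<Rightarrow> nat set" and g
  assume L: "\<And>x. x \<notin> R \<Longrightarrow> L x = {}" "\<And>x. x \<in> R \<Longrightarrow> L x = {g x}"
  have "requester_forces trunk m (L(v := {}))"
    using assms(1) requester_forces_cong[of trunk "L(v := {})" "\<lambda>_. {}" m] L(1) by simp
  then show "requester_forces G (m + k) L"
    using L assms(2) v_notin_R by (intro requester_trunk_ignoring[of m L g]) auto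
qed

subsection \<open>Supplier's strategies\<close>

text \<open>A leaf planned for the color of \<open>v\<close> has received that color first and needs
  a second one; every other leaf needs one.\<close>

lemma leaf_rounds_ge:
  assumes "list_coloring G L \<phi>"
    and "\<And>x. x \<in> R \<Longrightarrow> L x \<noteq> {} \<Longrightarrow> g x \<in> L x" "\<And>x. x \<in> R \<Longrightarrow> finite (L x)"
  shows "card R + fiber R g (\<phi> v) \<le> (\<Sum>x\<in>R. card (L x))"
proof -
  have "1 + (if g x = \<phi> v then 1 else 0) \<le> card (L x)" if "x \<in> R" for x
  proof -
    have x: "\<phi> x \<in> L x" "\<phi> x \<noteq> \<phi> v"
      using assms(1) that R_subset dominates_leaf unfolding list_coloring_def by blast+
    have "card {\<phi> x, g x} \<le> card (L x)"
      using x assms(2)[OF that] assms(3)[OF that] by (intro card_mono) auto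
    then show ?thesis
      using x(2) by (cases "g x = \<phi> v") (auto simp: card_insert_if split: if_splits)
  qed
  then have "(\<Sum>x\<in>R. 1 + (if g x = \<phi> v then 1 else 0)) \<le> (\<Sum>x\<in>R. card (L x))"
    by (rule sum_mono)
  moreover have "(\<Sum>x\<in>R. if g x = \<phi> v then 1 else 0) = fiber R g (\<phi> v)"
    using finite_R by (simp add: fiber_def sum.If_cases Int_def)
  ultimately show ?thesis
    unfolding sum.distrib by simp
qed

lemma leaf_answer:
  assumes "x \<in> R" "\<And>x. x \<in> R \<Longrightarrow> L x \<noteq> {} \<Longrightarrow> g x \<in> L x" "\<And>x. x \<in> R \<Longrightarrow> finite (L x)"
  obtains c where "c \<notin> L x"
    "\<And>y. y \<in> R \<Longrightarrow> add_color L x c y \<noteq> {} \<Longrightarrow> g y \<in> add_color L x c y"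
    "(\<Sum>y\<in>R. card (add_color L x c y)) = Suc (\<Sum>y\<in>R. card (L y))"
proof -
  obtain d where d: "d \<notin> L x"
    using assms(1,3) ex_new_if_finite infinite_UNIV_nat by blast
  define c where "c = (if L x = {} then g x else d)"
  have c: "c \<notin> L x"
    using d by (auto simp: c_def)
  have "g y \<in> add_color L x c y" if "y \<in> R" "add_color L x c y \<noteq> {}" for y
    using that assms(2)[of y] by (cases "y = x") (auto simp: c_def)
  moreover have "(\<Sum>y\<in>R. card (add_color L x c y)) = Suc (\<Sum>y\<in>R. card (L y))"
    using sum.remove[OF finite_R assms(1), of "\<lambda>y. card (L y)"]
      sum.remove[OF finite_R assms(1), of "\<lambda>y. card (add_color L x c y)"] c assms(1,3)
    by simp
  ultimately show thesis
    using c that by blast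
qed

lemma sum_card_add_color_outside:
  "x \<notin> R \<Longrightarrow> (\<Sum>y\<in>R. card (add_color L x c y)) = (\<Sum>y\<in>R. card (L y))"
  by (intro sum.cong) (auto simp: add_color_def)

text \<open>\<open>m\<close> is what the game on \<open>rest\<close> still owes, and
  \<open>v\<close> receives 0, 1, 2, ... in order. Color \<open>i\<close> takes \<open>i + 1\<close>
  requests at \<open>v\<close> and at least \<open>u - i\<close> second requests at leaves, together
  at least \<open>u + 1\<close>; hence a coloring with \<open>N > 0\<close> would need a debt
  \<open>m > 0\<close> on \<open>rest\<close>.\<close>

lemma supplier_star:
  assumes "supplier_forces rest m L" "\<And>x. finite (L x)" "L v = {..<j}"
    and "\<And>x. x \<in> R \<Longrightarrow> L x \<noteq> {} \<Longrightarrow> g x \<in> L x"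
    and "\<And>i. i < u \<Longrightarrow> u - i \<le> fiber R g i"
    and "N + (\<Sum>x\<in>R. card (L x)) + j \<le> m + card R + u + 1"
  shows "supplier_forces G N L"
  using assms(1-4,6)
proof (induction N arbitrary: m L j)
  case (Suc N)
  have not_colorable: "\<not> list_colorable G L"
  proof
    assume "list_colorable G L"
    then obtain \<phi> where \<phi>: "list_coloring G L \<phi>"
      by (auto simp: list_colorable_iff)
    then have "\<phi> v < j"
      using Suc.prems(3) v_in_verts unfolding list_coloring_def by blast
    \<comment> \<open>Truncated subtraction gives 0 for colors from \<open>u\<close> on, which
      already take more than \<open>u\<close> requests at \<open>v\<close>.\<close>
    moreover have "u - \<phi> v \<le> fiber R g (\<phi> v)"
      using assms(5)[of "\<phi> v"] by (cases "\<phi> v < u") auto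
    ultimately have "m \<noteq> 0"
      using leaf_rounds_ge[OF \<phi> Suc.prems(4,2)] Suc.prems(5) by linarith
    then obtain m' where "m = Suc m'"
      by (cases m) auto
    then have "\<not> list_colorable rest L"
      using Suc.prems(1) by simp
    then show False
      using \<phi> by (auto simp: list_colorable_def list_coloring_def dominates_delete_verts_iff)
  qed
  have "\<exists>c. c \<notin> L x \<and> supplier_forces G N (add_color L x c)" if "x \<in> verts G" for x
  proof -
    consider "x = v" | "x \<in> R" | "x \<in> verts rest"
      using \<open>x \<in> verts G\<close> by auto
    then show ?thesis
    proof cases
      case 1
      have "supplier_forces rest m (add_color L v j)"
        using Suc.prems(1) supplier_forces_cong[of rest "add_color L v j" L m] by simp
      moreover have "g y \<in> add_color L v j y" if "y \<in> R" "add_color L v j y \<noteq> {}" for y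
        using that Suc.prems(4)[of y] v_notin_R by (cases "y = v") auto
      ultimately have "supplier_forces G N (add_color L v j)"
        using Suc.prems v_notin_R
        by (intro Suc.IH[of m _ "Suc j"])
          (auto simp: lessThan_Suc sum_card_add_color_outside)
      then show ?thesis
        using 1 Suc.prems(3) by (intro exI[of _ j]) auto
    next
      case 2
      obtain c where c: "c \<notin> L x"
        "\<And>y. y \<in> R \<Longrightarrow> add_color L x c y \<noteq> {} \<Longrightarrow> g y \<in> add_color L x c y"
        "(\<Sum>y\<in>R. card (add_color L x c y)) = Suc (\<Sum>y\<in>R. card (L y))"
        using leaf_answer[OF 2, of L g] Suc.prems(2,4) by blast
      have "add_color L x c y = L y" if "y \<in> verts rest" for y
        using that 2 by (cases "y = x") auto
      then have "supplier_forces rest m (add_color L x c)"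
        using Suc.prems(1) supplier_forces_cong by blast
      moreover have "add_color L x c v = {..<j}"
        using 2 v_notin_R Suc.prems(3) by (metis add_color_other)
      ultimately have "supplier_forces G N (add_color L x c)"
        using Suc.prems(2,5) c by (intro Suc.IH[of m _ j]) auto
      then show ?thesis
        using c(1) by blast
    next
      case 3
      \<comment> \<open>For \<open>m = 0\<close> nothing is owed on \<open>rest\<close>, so any
        fresh color serves and \<open>m - 1\<close> is again 0.\<close>
      have "\<exists>c. c \<notin> L x \<and> supplier_forces rest (m - 1) (add_color L x c)"
      proof (cases m)
        case 0
        then show ?thesis
          using Suc.prems(2) ex_new_if_finite[of "L x"] infinite_UNIV_nat by auto
      next
        case (Suc m')
        then show ?thesis using Suc.prems(1) 3 by simp
      qed
      then obtain c where c: "c \<notin> L x" "supplier_forces rest (m - 1) (add_color L x c)"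
        by blast
      have x: "x \<noteq> v" "x \<notin> R"
        using 3 by auto
      have "g y \<in> add_color L x c y" if "y \<in> R" "add_color L x c y \<noteq> {}" for y
        using that Suc.prems(4)[of y] x by (cases "y = x") auto
      moreover have "add_color L x c v = {..<j}"
        using x Suc.prems(3) by (metis add_color_other)
      ultimately have "supplier_forces G N (add_color L x c)"
        using Suc.prems(2,5) c(2) x
        by (intro Suc.IH[of "m - 1" _ j]) (auto simp: sum_card_add_color_outside)
      then show ?thesis
        using c(1) by blast
    qed
  qed
  then show ?case
    using not_colorable by simp
qed simp

lemma supplier_lower_rest:
  assumes "supplier_forces rest m (\<lambda>_. {})" "tri u \<le> card R"
  shows "supplier_forces G (card R + (m + u + 1)) (\<lambda>_. {})"
proof -
  obtain g where "\<forall>i<u. u - i \<le> card {x\<in>R. g x = i}"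
    using ex_fibers_ge[OF finite_R, where a = "\<lambda>i. u - i" and u = u] assms(2) by (auto simp: sum_countdown)
  then show ?thesis
    using assms(1) by (intro supplier_star[of m _ 0 g u]) (auto simp: fiber_def)
qed

text \<open>A coloring of \<open>rest\<close> blocks at most one of two distinct colors at
  \<open>v\<close>. Hence Supplier cannot be promised more than two rounds on \<open>trunk\<close>
  once \<open>rest\<close> is colorable.\<close>

lemma requester_forces_trunk_2:
  assumes "list_coloring rest L \<phi>"
  shows "requester_forces trunk 2 L"
proof -
  have v: "v \<in> verts trunk"
    using v_in_verts v_notin_R by simp
  have "list_colorable trunk (add_color (add_color L v c) v d)"
    if "d \<notin> add_color L v c v" for c d
  proof -
    let ?L = "add_color (add_color L v c) v d"
    have "c \<noteq> d" using that by auto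
    then obtain e where "e \<in> {c, d}" "e \<notin> \<phi> ` D"
      using D_unique by blast
    moreover have "list_coloring rest ?L \<phi>"
      using assms by (rule list_coloring_mono) (auto simp: add_color_def)
    ultimately show ?thesis
      using list_coloring_trunk_extend[of ?L \<phi> e] by (auto simp: list_colorable_iff)
  qed
  then show ?thesis
    unfolding numeral_2_eq_2
    using v by (intro requester_forces_ask[of v] requester_forces_colorable)
qed

text \<open>\<open>M\<close> is the position of Supplier's game on \<open>trunk\<close>, whose colors are shifted by \<open>u\<close> in \<open>G\<close>.
  The first \<open>u\<close> requests at \<open>v\<close> are answered by \<open>0, \<dots>, u - 1\<close> and not passed on to that game.  If
  the final color of \<open>v\<close> is one of these, then at most two rounds on \<open>trunk\<close> are missing.\<close>

lemma supplier_trunk: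
  assumes "supplier_forces trunk m M" "\<And>x. finite (M x)" "\<And>x. x \<in> R \<Longrightarrow> finite (L x)"
    and "\<And>x. x \<in> verts rest \<Longrightarrow> L x = (\<lambda>c. c + u) ` M x"
    and "L v = {..<i} \<union> (\<lambda>c. c + u) ` M v" "i \<le> u" "M v \<noteq> {} \<Longrightarrow> i = u"
    and "\<And>x. x \<in> R \<Longrightarrow> L x \<noteq> {} \<Longrightarrow> g x \<in> L x"
    and "\<And>i. i < u \<Longrightarrow> Suc u - i \<le> fiber R g i"
    and "N + (\<Sum>x\<in>R. card (L x)) + i \<le> m + card R + u"
  shows "supplier_forces G N L"
  using assms(1-8,10)
proof (induction N arbitrary: m L M i)
  case (Suc N)
  have not_colorable: "\<not> list_colorable G L"
  proof
    assume "list_colorable G L"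
    then obtain \<phi> where \<phi>: "list_coloring G L \<phi>"
      by (auto simp: list_colorable_iff)
    have rounds: "card R + fiber R g (\<phi> v) \<le> (\<Sum>x\<in>R. card (L x))"
      using leaf_rounds_ge[OF \<phi>, of g] Suc.prems(3,8) by blast
    \<comment> \<open>All colors on \<open>rest\<close> are at least \<open>u\<close>, so
      subtracting \<open>u\<close> keeps different colors different.\<close>
    have rest: "list_coloring rest M (\<lambda>x. \<phi> x - u)"
    proof -
      have shifted: "\<phi> x \<in> (\<lambda>c. c + u) ` M x" if "x \<in> verts rest" for x
        using \<phi> Suc.prems(4)[OF that] that unfolding list_coloring_def by auto
      have "\<phi> x - u \<noteq> \<phi> y - u" if "x \<rightarrow>\<^bsub>rest\<^esub> y" for x y
      proof -
        have "x \<rightarrow>\<^bsub>G\<^esub> y" "x \<in> verts rest" "y \<in> verts rest"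
          using that adj_in_verts by (auto simp: dominates_delete_verts_iff)
        then have "\<phi> x \<noteq> \<phi> y" "u \<le> \<phi> x" "u \<le> \<phi> y"
          using \<phi> shifted[of x] shifted[of y] unfolding list_coloring_def by auto
        then show ?thesis by simp
      qed
      then show ?thesis
        using shifted unfolding list_coloring_def by fastforce
    qed
    have v: "\<phi> v \<in> {..<i} \<union> (\<lambda>c. c + u) ` M v"
      using \<phi> v_in_verts Suc.prems(5) unfolding list_coloring_def by blast
    show False
    proof (cases "\<phi> v < i")
      case True
      then have "Suc u - \<phi> v \<le> fiber R g (\<phi> v)"
        using Suc.prems(6) assms(9) by simp
      \<comment> \<open>At least \<open>\<phi> v + 1\<close> requests at \<open>v\<close> and a
        price of at least \<open>u + 1 - \<phi> v\<close> exceed the allowance \<open>u\<close> by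
        two.\<close>
      then have "2 < m"
        using True rounds Suc.prems(6,9) by linarith
      then show False
        using supplier_forces_imp_not_requester_forces[OF Suc.prems(1) _ Suc.prems(2)]
          requester_forces_trunk_2[OF rest] by blast
    next
      case False
      then obtain e where e: "e \<in> M v" "\<phi> v = e + u"
        using v by auto
      \<comment> \<open>The requests withheld at \<open>v\<close> have used up the allowance
        \<open>u\<close>, so the game on \<open>trunk\<close> still owes a round.\<close>
      then have "i = u"
        using Suc.prems(7) by blast
      then have "m \<noteq> 0"
        using Suc.prems(9) rounds by linarith
      then obtain m' where "m = Suc m'"
        by (cases m) auto
      then have not: "\<not> list_colorable trunk M"
        using Suc.prems(1) by simp
      have "e \<notin> (\<lambda>x. \<phi> x - u) ` D"
      proof
        assume "e \<in> (\<lambda>x. \<phi> x - u) ` D"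
        then obtain p where p: "p \<in> D" "e = \<phi> p - u" by blast
        then have "\<phi> p \<in> L p" "\<phi> v \<noteq> \<phi> p" "p \<in> verts rest"
          using \<phi> D_subset dominates_v unfolding list_coloring_def by auto
        then show False
          using Suc.prems(4)[of p] e p by auto
      qed
      then have "list_coloring trunk M ((\<lambda>x. \<phi> x - u)(v := e))"
        using rest e by (intro list_coloring_trunk_extend)
      then show False
        using not by (auto simp: list_colorable_iff)
    qed
  qed
  have "\<exists>c. c \<notin> L x \<and> supplier_forces G N (add_color L x c)" if "x \<in> verts G" for x
  proof -
    \<comment> \<open>Requests outside the leaves are answered by the game on \<open>trunk\<close>,
      at \<open>v\<close> only after the withheld ones.\<close>
    have via_trunk: ?thesis if x: "x \<in> verts trunk" and full: "x = v \<Longrightarrow> i = u"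
    proof -
      have xR: "x \<notin> R" using x by simp
      have "\<exists>c. c \<notin> M x \<and> supplier_forces trunk (m - 1) (add_color M x c)"
      proof (cases m)
        case 0
        then show ?thesis
          using Suc.prems(2) ex_new_if_finite[of "M x"] infinite_UNIV_nat by auto
      next
        case (Suc m')
        then show ?thesis using Suc.prems(1) x by simp
      qed
      then obtain c where c: "c \<notin> M x" "supplier_forces trunk (m - 1) (add_color M x c)"
        by blast
      let ?L = "add_color L x (c + u)" and ?M = "add_color M x c"
      \<comment> \<open>The shift keeps this answer apart from the reserved colors below
        \<open>u\<close>.\<close>
      have new: "c + u \<notin> L x"
        using c(1) x full Suc.prems(4)[of x] Suc.prems(5) by (cases "x = v") auto
      have rest: "?L y = (\<lambda>c. c + u) ` ?M y" if "y \<in> verts rest" for y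
        using Suc.prems(4)[OF that] by (cases "y = x") auto
      have v: "?L v = {..<i} \<union> (\<lambda>c. c + u) ` ?M v"
        using Suc.prems(5) by (cases "x = v") auto
      have full': "i = u" if "?M v \<noteq> {}"
        using that full Suc.prems(7) by (cases "x = v") auto
      have leaves: "?L y = L y" if "y \<in> R" for y
        using that xR by (metis add_color_other)
      have "supplier_forces G N ?L"
        using Suc.prems(2,3,6,8,9) c(2) rest v full' leaves xR
        by (intro Suc.IH[of "m - 1" ?M _ i]) (auto simp: sum_card_add_color_outside)
      then show ?thesis
        using new by blast
    qed
    consider "x \<in> verts trunk" "x = v \<Longrightarrow> i = u" | "x = v" "i < u" | "x \<in> R"
      using \<open>x \<in> verts G\<close> Suc.prems(6) by fastforce
    then show ?thesis
    proof cases
      case 1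
      then show ?thesis by (rule via_trunk)
    next
      case 2
      then have M: "M v = {}"
        using Suc.prems(7) by auto
      have leaves: "add_color L v i y = L y" if "y \<in> R" for y
        using that v_notin_R by (metis add_color_other)
      have "supplier_forces G N (add_color L v i)"
        using Suc.prems 2 M leaves v_notin_R
        by (intro Suc.IH[of m M _ "Suc i"])
          (auto simp: lessThan_Suc sum_card_add_color_outside)
      then show ?thesis
        using 2 M Suc.prems(5) by (intro exI[of _ i]) auto
    next
      case 3
      obtain c where c: "c \<notin> L x"
        "\<And>y. y \<in> R \<Longrightarrow> add_color L x c y \<noteq> {} \<Longrightarrow> g y \<in> add_color L x c y"
        "(\<Sum>y\<in>R. card (add_color L x c y)) = Suc (\<Sum>y\<in>R. card (L y))"
        using leaf_answer[OF 3, of L g] Suc.prems(3,8) by blast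
      have outside: "add_color L x c y = L y" if "y \<notin> R" for y
        using that 3 by (metis add_color_other)
      have "supplier_forces G N (add_color L x c)"
        using Suc.prems c outside v_notin_R
        by (intro Suc.IH[of m M _ i]) auto
      then show ?thesis
        using c(1) by blast
    qed
  qed
  then show ?case
    using not_colorable by simp
qed simp

lemma supplier_lower_trunk:
  assumes "supplier_forces trunk m (\<lambda>_. {})" "tri (Suc u) \<le> card R + 1"
  shows "supplier_forces G (card R + (m + u)) (\<lambda>_. {})"
proof -
  obtain g where "\<forall>i<u. Suc u - i \<le> card {x\<in>R. g x = i}"
    using ex_fibers_ge[OF finite_R, where a = "\<lambda>i. Suc u - i" and u = u] assms(2) sum_countdown_Suc[of u] by auto
  then show ?thesis
    using assms(1) by (intro supplier_trunk[of m "\<lambda>_. {}" _ u 0 g]) (auto simp: fiber_def)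
qed

section \<open>The value of the game in the two cases\<close>

lemma chi_ISC_nontriangular:
  assumes "\<not> triangular (card R + 1)"
  shows "chi_ISC G = chi_ISC rest + card R + 1 + tri_index (card R)"
proof (rule antisym)
  interpret rest: graph rest by (rule graph_delete_verts)
  let ?u = "tri_index (card R)"
  have forces: "requester_forces rest (chi_ISC rest) (\<lambda>_. {})"
    "supplier_forces rest (chi_ISC rest) (\<lambda>_. {})"
    using rest.chi_ISC_eq_iff by blast+
  \<comment> \<open>\<open>card R < tri (Suc ?u)\<close> always holds; as \<open>card R + 1\<close>
    is not triangular, the gap is at least two.\<close>
  have "card R + 1 < tri (Suc ?u)"
    using assms tri_index_bounds(2)[of "card R"] triangular_Suc_iff[of "card R"] by linarith
  from chi_ISC_leI[OF requester_upper_rest[OF forces(1) this]]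
  show "chi_ISC G \<le> chi_ISC rest + card R + 1 + ?u" by simp
  from chi_ISC_geI[OF supplier_lower_rest[OF forces(2) tri_index_bounds(1)]]
  show "chi_ISC rest + card R + 1 + ?u \<le> chi_ISC G" by simp
qed

lemma chi_ISC_triangular:
  assumes "triangular (card R + 1)"
  shows "chi_ISC G = chi_ISC trunk + card R + tri_index (card R)"
proof (rule antisym)
  interpret trunk: graph trunk by (rule graph_delete_verts)
  let ?u = "tri_index (card R)"
  have forces: "requester_forces trunk (chi_ISC trunk) (\<lambda>_. {})"
    "supplier_forces trunk (chi_ISC trunk) (\<lambda>_. {})"
    using trunk.chi_ISC_eq_iff by blast+
  from chi_ISC_leI[OF requester_upper_trunk[OF forces(1) tri_index_bounds(2)]]
  show "chi_ISC G \<le> chi_ISC trunk + card R + ?u" by simp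
  have "tri (Suc ?u) \<le> card R + 1"
    using assms triangular_Suc_iff[of "card R"] by simp
  from chi_ISC_geI[OF supplier_lower_trunk[OF forces(2) this]]
  show "chi_ISC trunk + card R + ?u \<le> chi_ISC G" by simp
qed

end

section \<open>Stems as pendant stars\<close>

lemma (in graph) leaf_dominates_unique:
  assumes "leaf G x" "x \<rightarrow>\<^bsub>G\<^esub> y" "x \<rightarrow>\<^bsub>G\<^esub> z"
  shows "y = z"
proof -
  obtain e where e: "out_arcs G x = {e}"
    using assms(1) by (auto simp: leaf_def out_degree_def card_1_singleton_iff)
  have "head G e = w" if "x \<rightarrow>\<^bsub>G\<^esub> w" for w
  proof -
    obtain a where "a \<in> out_arcs G x" "head G a = w"
      using \<open>x \<rightarrow>\<^bsub>G\<^esub> w\<close> by (auto simp: arcs_ends_conv)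
    then show ?thesis
      using e by simp
  qed
  then show ?thesis
    using assms(2,3) by metis
qed

lemma (in graph) pendant_star_stem:
  assumes "stem G v"
  shows "pendant_star G v (leaf_neighbors G v) {y \<in> neighbors G v. \<not> leaf G y}"
proof
  let ?D = "{y \<in> neighbors G v. \<not> leaf G y}"
  show "v \<in> verts G"
    using assms by (simp add: stem_def)
  show "leaf_neighbors G v \<subseteq> verts G"
    by (auto simp: leaf_neighbors_def leaf_def)
  show "v \<notin> leaf_neighbors G v"
    using adj_not_same by (auto simp: leaf_neighbors_def neighbors_def)
  show "v \<rightarrow>\<^bsub>G\<^esub> y \<longleftrightarrow> y \<in> leaf_neighbors G v \<union> ?D" for y
    by (auto simp: leaf_neighbors_def neighbors_def)
  show "x \<rightarrow>\<^bsub>G\<^esub> y \<longleftrightarrow> y = v" if "x \<in> leaf_neighbors G v" for x y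
    using that leaf_dominates_unique arcs_ends_symmetric[OF sym_arcs]
    unfolding leaf_neighbors_def neighbors_def by blast
  show "leaf_neighbors G v \<inter> ?D = {}"
    by (auto simp: leaf_neighbors_def)
  \<comment> \<open>Excludes the default value 0 that \<open>card\<close> takes on infinite
    sets.\<close>
  have "finite ?D"
    using adj_in_verts by (intro finite_subset[OF _ finite_verts]) (auto simp: neighbors_def)
  then show "p = q" if "p \<in> ?D" "q \<in> ?D" for p q
    using assms that card_le_Suc0_iff_eq[of ?D] by (simp add: stem_def)
qed

theorem theorem5p1:
  fixes T :: "('a,'b) pre_digraph"
  assumes "finite_forest T"
  shows "(arcs T = {} \<longrightarrow> chi_ISC T = card (verts T)) \<and>
    (\<forall>v R r. stem T v \<and> R = leaf_neighbors T v \<and> r = card R \<longrightarrow>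
       chi_ISC T =
         (if \<not> triangular (r + 1)
          then chi_ISC (delete_verts T (R \<union> {v})) + r + 1 + tri_index r
          else chi_ISC (delete_verts T R) + r + tri_index r))"
proof -
  interpret graph T
    using assms by (simp add: finite_forest_def)
  show ?thesis
    using chi_ISC_edgeless pendant_star.chi_ISC_nontriangular[OF pendant_star_stem]
      pendant_star.chi_ISC_triangular[OF pendant_star_stem] by auto
qed

end
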